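(* There exists a universal constant $C>0$ such that the following holds. Let $\mathcal X$ be a $d$-dimensional subspace of $\mathbb R^N$, and let $\mathcal X_1,\mathcal X_2\subseteq\mathcal X$ be subspaces of dimensions $d_1$ and $d_2$ respectively, with $d_1\le d_2$. Let $\mathbf U\in\mathbb R^{N\times d}$ be a matrix whose columns constitute an orthonormal basis of $\mathcal X$. Suppose $\mathbf\Phi$ is a (deterministic) real $n\times N$ matrix satisfying, for some $\delta\in(0,1/4)$, $$1-\delta<s_{\min}^2(\mathbf\Phi\mathbf U)\le s_{\max}^2(\mathbf\Phi\mathbf U)<1+\delta.$$ Let $\mathcal Y_i=\mathbf\Phi\mathcal X_i$ for $i=1,2$. Then $$\left|\operatorname{aff}^2(\mathcal Y_1,\mathcal Y_2)-\operatorname{aff}^2(\mathcal X_1,\mathcal X_2)\right|\le C\left(d_1-\operatorname{aff}^2(\mathcal X_1,\mathcal X_2)\right)\delta.$$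
   Context: For subspaces $\mathcal A,\mathcal B$ of a Euclidean space, the affinity is $\operatorname{aff}(\mathcal A,\mathcal B)=\sqrt{\operatorname{tr}(\mathcal P_{\mathcal A}\mathcal P_{\mathcal B})}$, where $\mathcal P_{\mathcal A},\mathcal P_{\mathcal B}$ are the matrices of orthogonal projection onto $\mathcal A,\mathcal B$. For a matrix $\mathbf M$ with $d$ columns, $s_{\max}(\mathbf M)=\max_{\|\mathbf x\|=1}\|\mathbf M\mathbf x\|$ and $s_{\min}(\mathbf M)=\min_{\|\mathbf x\|=1}\|\mathbf M\mathbf x\|$ are its largest and smallest singular values ($\|\cdot\|$ is the Euclidean norm). *)

theory Defs
  imports Jordan_Normal_Form.VS_Connect
begin

text \<open>
  The constant of the theorem has to be uniform in all dimensions, so \<open>\<real>\<^sup>N\<close> is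
  \<open>carrier_vec N :: real vec set\<close>, with the dimension a natural number rather than a type.
\<close>

abbreviation is_subspace :: "nat \<Rightarrow> real vec set \<Rightarrow> bool" where
  "is_subspace N W \<equiv> VectorSpace.subspace class_ring W (module_vec TYPE(real) N)"

text \<open>A subspace of \<open>\<real>\<^sup>N\<close>, regarded as a vector space in its own right.\<close>

abbreviation subspace_vs :: "nat \<Rightarrow> real vec set \<Rightarrow> (real, real vec) module" where
  "subspace_vs N W \<equiv> (module_vec TYPE(real) N)\<lparr>carrier := W\<rparr>"

abbreviation subspace_dim :: "nat \<Rightarrow> real vec set \<Rightarrow> nat" where
  "subspace_dim N W \<equiv> vectorspace.dim class_ring (subspace_vs N W)"

definition euclid_norm :: "real vec \<Rightarrow> real" where
  "euclid_norm x = sqrt (x \<bullet> x)"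

definition mat_trace :: "real mat \<Rightarrow> real" where
  "mat_trace A = (\<Sum>i<dim_row A. A $$ (i, i))"

text \<open>The definite description is meaningful only if \<open>W\<close> is a subspace of \<open>\<real>\<^sup>N\<close>.\<close>

definition proj_mat :: "nat \<Rightarrow> real vec set \<Rightarrow> real mat" where
  "proj_mat N W = (THE P. P \<in> carrier_mat N N \<and>
     (\<forall>v \<in> carrier_vec N. P *\<^sub>v v \<in> W \<and> (\<forall>w \<in> W. (v - P *\<^sub>v v) \<bullet> w = 0)))"

definition aff :: "nat \<Rightarrow> real vec set \<Rightarrow> real vec set \<Rightarrow> real" where
  "aff N A B = sqrt (mat_trace (proj_mat N A * proj_mat N B))"

text \<open>
  For a matrix with at least one column, the supremum and the infimum below are attained, by
  compactness of the unit sphere. For a matrix without columns both are unspecified.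
\<close>

definition s_max :: "real mat \<Rightarrow> real" where
  "s_max M = (SUP x \<in> {x \<in> carrier_vec (dim_col M). euclid_norm x = 1}. euclid_norm (M *\<^sub>v x))"

definition s_min :: "real mat \<Rightarrow> real" where
  "s_min M = (INF x \<in> {x \<in> carrier_vec (dim_col M). euclid_norm x = 1}. euclid_norm (M *\<^sub>v x))"

definition orthonormal_basis_cols :: "nat \<Rightarrow> real vec set \<Rightarrow> real mat \<Rightarrow> bool" where
  "orthonormal_basis_cols N W U \<longleftrightarrow>
     vectorspace.basis class_ring (subspace_vs N W) (set (cols U)) \<and>
     (\<forall>i < dim_col U. \<forall>j < dim_col U. col U i \<bullet> col U j = (if i = j then 1 else 0))"

end

theory Submission
  imports Defs Jordan_Normal_Form.DL_Rank
begin

text \<open>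
  If the columns of \<open>V\<close> form an orthonormal basis of \<open>A\<close>, then \<open>dim A - aff\<^sup>2(A, B)\<close> is the sum
  of the squared distances of these columns to \<open>B\<close>, that is \<open>\<parallel>(I - P\<^sub>B) V\<parallel>\<^sub>F\<^sup>2\<close>. Replacing the
  orthonormal basis of \<open>A\<close> by \<open>V K\<close> increases this Frobenius norm at most by the factor
  \<open>\<parallel>K\<parallel>\<^sup>2\<close>, and a map that distorts squared norms by at most a constant factor distorts squared
  distances to a subspace by at most the same factor. Applied to \<open>\<Phi>\<close> on \<open>X\<close> and to its inverse
  on \<open>\<Phi> X\<close>, both facts together show that \<open>d\<^sub>1 - aff\<^sup>2\<close> changes by a factor between
  \<open>(1 - \<delta>) / (1 + \<delta>)\<close> and \<open>(1 + \<delta>) / (1 - \<delta>)\<close>, so \<open>C = 3\<close> works.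
\<close>

section \<open>Subspaces of \<open>carrier_vec N\<close> and their images under matrices\<close>

text \<open>Unfolds the module-theoretic predicate once, so that later arguments use closure
  conditions instead of locale interpretations.\<close>

lemma is_subspace_iff:
  "is_subspace N W \<longleftrightarrow> W \<subseteq> carrier_vec N \<and> 0\<^sub>v N \<in> W \<and>
     (\<forall>v\<in>W. \<forall>w\<in>W. v + w \<in> W) \<and> (\<forall>c. \<forall>v\<in>W. c \<cdot>\<^sub>v v \<in> W)"
  using vec_vs[of N, where 'a=real] vec_module[of N, where 'a=real]
  unfolding VectorSpace.subspace_def submodule_def
  by (auto simp: module_vec_simps class_ring_simps)

lemma is_subspaceD:
  assumes "is_subspace N W"
  shows "v \<in> W \<Longrightarrow> v \<in> carrier_vec N" "0\<^sub>v N \<in> W"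
    "v \<in> W \<Longrightarrow> w \<in> W \<Longrightarrow> v + w \<in> W" "v \<in> W \<Longrightarrow> c \<cdot>\<^sub>v v \<in> W"
  using assms unfolding is_subspace_iff by auto

lemma is_subspace_diff:
  assumes "is_subspace N W" "v \<in> W" "w \<in> W"
  shows "v - w \<in> W"
proof -
  have "v - w = v + (-1) \<cdot>\<^sub>v w"
    using assms(2,3)[THEN is_subspaceD(1)[OF assms(1)]] by auto
  thus ?thesis using is_subspaceD[OF assms(1)] assms(2,3) by metis
qed

lemma mult_mat_vec_in_subspace:
  assumes W: "is_subspace N W" and B: "B \<in> carrier_mat N m"
    and cols: "\<And>j. j < m \<Longrightarrow> col B j \<in> W" and c: "c \<in> carrier_vec m"
  shows "B *\<^sub>v c \<in> W"
proof -
  \<comment> \<open>Induction on the number of columns used: each partial combination is written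
    entrywise, and the next column adds one scaled element of \<open>W\<close>.\<close>
  have "k \<le> m \<Longrightarrow> vec N (\<lambda>i. \<Sum>j<k. c $ j * B $$ (i, j)) \<in> W" for k
  proof (induction k)
    case 0
    have "vec N (\<lambda>i. \<Sum>j<0. c $ j * B $$ (i, j)) = 0\<^sub>v N" by auto
    then show ?case using is_subspaceD(2)[OF W] by simp
  next
    case (Suc k)
    have "vec N (\<lambda>i. \<Sum>j<Suc k. c $ j * B $$ (i, j)) =
        vec N (\<lambda>i. \<Sum>j<k. c $ j * B $$ (i, j)) + c $ k \<cdot>\<^sub>v col B k"
      using B Suc.prems by auto
    then show ?case
      using is_subspaceD(3,4)[OF W] Suc cols[of k] by auto
  qed
  from this[of m] have "vec N (\<lambda>i. \<Sum>j<m. c $ j * B $$ (i, j)) \<in> W" by simp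
  moreover have "vec N (\<lambda>i. \<Sum>j<m. c $ j * B $$ (i, j)) = B *\<^sub>v c"
    using B c by (auto simp: scalar_prod_def lessThan_atLeast0 mult.commute intro!: sum.cong)
  ultimately show ?thesis by simp
qed

lemma is_subspace_image:
  assumes W: "is_subspace N W" and F: "F \<in> carrier_mat n N"
  shows "is_subspace n ((\<lambda>x. F *\<^sub>v x) ` W)"
  unfolding is_subspace_iff
proof (intro conjI ballI allI)
  note C = is_subspaceD[OF W]
  show "(\<lambda>x. F *\<^sub>v x) ` W \<subseteq> carrier_vec n" using F C by auto
  have "F *\<^sub>v 0\<^sub>v N = 0\<^sub>v n" using F by auto
  thus "0\<^sub>v n \<in> (\<lambda>x. F *\<^sub>v x) ` W" using C(2) by (metis imageI)
  show "v + w \<in> (\<lambda>x. F *\<^sub>v x) ` W"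
    if "v \<in> (\<lambda>x. F *\<^sub>v x) ` W" "w \<in> (\<lambda>x. F *\<^sub>v x) ` W" for v w
  proof -
    from that obtain x y where "x \<in> W" "y \<in> W" "v = F *\<^sub>v x" "w = F *\<^sub>v y" by auto
    thus ?thesis using C F mult_add_distrib_mat_vec[OF F C(1) C(1), of x y] by (metis imageI)
  qed
  show "c \<cdot>\<^sub>v v \<in> (\<lambda>x. F *\<^sub>v x) ` W" if "v \<in> (\<lambda>x. F *\<^sub>v x) ` W" for c v
  proof -
    from that obtain x where "x \<in> W" "v = F *\<^sub>v x" by auto
    thus ?thesis using C mult_mat_vec[OF F C(1), of x c] by (metis imageI)
  qed
qed

section \<open>Columns of a matrix: independence, span and dimension\<close>

lemma mat_mult_unit_vec_eq_col:
  fixes B :: "'a :: semiring_1 mat"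
  assumes "B \<in> carrier_mat N m" "j < m"
  shows "B *\<^sub>v unit_vec m j = col B j"
  using assms by (intro eq_vecI) auto

text \<open>Equal columns \<open>i\<close> and \<open>j\<close> would put the difference of two unit
  vectors into the kernel. Distinctness is stated separately because linear independence of the set
  of columns does not see repetitions.\<close>

lemma cols_lin_indpt:
  fixes B :: "real mat"
  assumes B: "B \<in> carrier_mat N m"
    and inj: "\<And>c. c \<in> carrier_vec m \<Longrightarrow> B *\<^sub>v c = 0\<^sub>v N \<Longrightarrow> c = 0\<^sub>v m"
  shows "distinct (cols B)"
    and "\<not> LinearCombinations.module.lin_dep class_ring (module_vec TYPE(real) N) (set (cols B))"
proof -
  interpret vec_space "TYPE(real)" N .
  show d: "distinct (cols B)"
  proof (rule ccontr)
    assume "\<not> distinct (cols B)"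
    then obtain i j where ij: "i < m" "j < m" "i \<noteq> j" "col B i = col B j"
      using B by (auto simp: distinct_conv_nth)
    have "B *\<^sub>v (unit_vec m i - unit_vec m j) = 0\<^sub>v N"
      using mult_minus_distrib_mat_vec[OF B, of "unit_vec m i" "unit_vec m j"]
        mat_mult_unit_vec_eq_col[OF B] ij B by auto
    hence "unit_vec m i - unit_vec m j = (0\<^sub>v m :: real vec)" by (rule inj[rotated]) auto
    hence "(unit_vec m i - unit_vec m j) $ i = (0::real)" using ij by auto
    thus False using ij by auto
  qed
  show "lin_indpt (set (cols B))"
    using lin_depE[OF B _ d] inj by metis
qed

text \<open>Serves to bound the size of orthonormal systems, so that one of maximal size
  exists.\<close>

lemma inj_mat_cols_le:
  fixes B :: "real mat"
  assumes B: "B \<in> carrier_mat N m"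
    and inj: "\<And>c. c \<in> carrier_vec m \<Longrightarrow> B *\<^sub>v c = 0\<^sub>v N \<Longrightarrow> c = 0\<^sub>v m"
  shows "m \<le> N"
proof -
  interpret vec_space "TYPE(real)" N .
  note li = cols_lin_indpt[OF B inj]
  have "card (set (cols B)) \<le> dim"
    using li_le_dim(2)[OF fin_dim _ li(2)] B cols_dim[of B] by auto
  thus ?thesis using dim_is_n distinct_card[OF li(1)] B by auto
qed

text \<open>Distinctness makes coefficients indexed by vectors and coefficients indexed by column
  numbers interchangeable; \<open>find_first\<close> recovers the number from the vector.\<close>

lemma span_cols_eq_range:
  fixes B :: "real mat"
  assumes B: "B \<in> carrier_mat N m" and d: "distinct (cols B)"
  shows "LinearCombinations.module.span class_ring (module_vec TYPE(real) N) (set (cols B)) =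
    (\<lambda>c. B *\<^sub>v c) ` carrier_vec m"
proof -
  interpret vec_space "TYPE(real)" N .
  have sub: "set (cols B) \<subseteq> carrier_vec N" using B cols_dim[of B] by auto
  show ?thesis
  proof (intro equalityI subsetI)
    fix x assume "x \<in> span (set (cols B))"
    then obtain a where "x = lincomb a (set (cols B))"
      using finite_span[OF _ sub] by auto
    hence "x = B *\<^sub>v vec m (\<lambda>i. a (col B i))"
      using mat_mult_eq_lincomb[OF B d, of a] by simp
    thus "x \<in> (\<lambda>c. B *\<^sub>v c) ` carrier_vec m" by auto
  next
    fix x assume "x \<in> (\<lambda>c. B *\<^sub>v c) ` carrier_vec m"
    then obtain c where "c \<in> carrier_vec m" "x = B *\<^sub>v c" by auto
    hence "x = lincomb (\<lambda>a. c $ find_first a (cols B)) (set (cols B))"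
      using lincomb_eq_mat_mult[OF B _ d] by auto
    thus "x \<in> span (set (cols B))"
      using finite_span[OF _ sub] by auto
  qed
qed

text \<open>The columns of \<open>B\<close> are a basis of \<open>W\<close>. Span and independence
  are computed in the ambient space and carried over to \<open>W\<close> by
  \<open>span_li_not_depend\<close>.\<close>

lemma subspace_dim_eqI:
  assumes W: "is_subspace N W" and B: "B \<in> carrier_mat N m"
    and inj: "\<And>c. c \<in> carrier_vec m \<Longrightarrow> B *\<^sub>v c = 0\<^sub>v N \<Longrightarrow> c = 0\<^sub>v m"
    and range: "(\<lambda>c. B *\<^sub>v c) ` carrier_vec m = W"
  shows "subspace_dim N W = m"
proof -
  interpret vec_space "TYPE(real)" N .
  interpret W: vectorspace class_ring "subspace_vs N W" by (rule subspace_is_vs[OF W])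
  note li = cols_lin_indpt[OF B inj]
  have sm: "submodule class_ring W V" using W by simp
  have sub: "set (cols B) \<subseteq> W"
  proof
    fix x assume "x \<in> set (cols B)"
    then obtain j where "j < m" "x = col B j" using B by (auto simp: in_set_conv_nth)
    hence "x = B *\<^sub>v unit_vec m j" using mat_mult_unit_vec_eq_col[OF B] by simp
    thus "x \<in> W" unfolding range[symmetric] by auto
  qed
  have "W.basis (set (cols B))"
    unfolding W.basis_def
    using span_li_not_depend[OF sub sm] li(2) span_cols_eq_range[OF B li(1)] range sub by auto
  hence "W.dim = card (set (cols B))" by (intro W.dim_basis) auto
  thus ?thesis using distinct_card[OF li(1)] B by auto
qed

text \<open>Brings the hypothesis on \<open>U\<close> into matrix form. Equal columns at different
  positions would have scalar product both 0 and 1, so the columns are distinct and the span is a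
  range.\<close>

lemma orthonormal_basis_cols_range:
  assumes W: "is_subspace N W" and U: "U \<in> carrier_mat N d" and onb: "orthonormal_basis_cols N W U"
  shows "transpose_mat U * U = 1\<^sub>m d" "(\<lambda>c. U *\<^sub>v c) ` carrier_vec d = W"
proof -
  interpret vec_space "TYPE(real)" N .
  interpret W: vectorspace class_ring "subspace_vs N W" by (rule subspace_is_vs[OF W])
  have orth: "\<And>i j. i < d \<Longrightarrow> j < d \<Longrightarrow> col U i \<bullet> col U j = (if i = j then 1 else 0)"
    and bas: "W.basis (set (cols U))"
    using onb U unfolding orthonormal_basis_cols_def by auto
  show "transpose_mat U * U = 1\<^sub>m d" using U orth by (intro eq_matI) auto
  have "distinct (cols U)"
  proof (rule ccontr)
    assume "\<not> distinct (cols U)"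
    then obtain i j where ij: "i < d" "j < d" "i \<noteq> j" "col U i = col U j"
      using U by (auto simp: distinct_conv_nth)
    thus False using orth[of i j] orth[of i i] by auto
  qed
  moreover have "submodule class_ring W V" using W by simp
  moreover have "set (cols U) \<subseteq> W" "W.span (set (cols U)) = W"
    using bas unfolding W.basis_def by auto
  ultimately show "(\<lambda>c. U *\<^sub>v c) ` carrier_vec d = W"
    using span_cols_eq_range[OF U] span_li_not_depend(1)[of "set (cols U)" W] by auto
qed

section \<open>Orthonormal frames of a subspace\<close>

text \<open>An orthonormal basis given by a matrix equation and a range, which suits computation
  better than the basis predicate of the vector space.\<close>

definition orthonormal_frame :: "nat \<Rightarrow> nat \<Rightarrow> real vec set \<Rightarrow> real mat \<Rightarrow> bool" where
  "orthonormal_frame N m W V \<longleftrightarrow> V \<in> carrier_mat N m \<and> transpose_mat V * V = 1\<^sub>m m \<and>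
     (\<lambda>c. V *\<^sub>v c) ` carrier_vec m = W"

lemma scalar_prod_mult_mat_vec:
  fixes A :: "real mat"
  assumes "A \<in> carrier_mat n m" "x \<in> carrier_vec m" "y \<in> carrier_vec n"
  shows "(A *\<^sub>v x) \<bullet> y = x \<bullet> (transpose_mat A *\<^sub>v y)"
proof -
  have "(A *\<^sub>v x) \<bullet> y = y \<bullet> (A *\<^sub>v x)" using assms by (intro comm_scalar_prod) auto
  also have "\<dots> = (transpose_mat A *\<^sub>v y) \<bullet> x" using transpose_vec_mult_scalar[OF assms] by simp
  also have "\<dots> = x \<bullet> (transpose_mat A *\<^sub>v y)" using assms by (intro comm_scalar_prod) auto
  finally show ?thesis .
qed

lemma scalar_prod_self_nonneg: "(x :: real vec) \<bullet> x \<ge> 0"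
  by (auto simp: scalar_prod_def intro!: sum_nonneg)

lemma scalar_prod_self_eq_0: "(x :: real vec) \<in> carrier_vec n \<Longrightarrow> x \<bullet> x = 0 \<longleftrightarrow> x = 0\<^sub>v n"
  using conjugate_square_eq_0_vec[of x n] by simp

lemma orthonormal_cols_isometry:
  fixes V :: "real mat"
  assumes V: "V \<in> carrier_mat N m" and o: "transpose_mat V * V = 1\<^sub>m m"
    and c: "c \<in> carrier_vec m" "e \<in> carrier_vec m"
  shows "(V *\<^sub>v c) \<bullet> (V *\<^sub>v e) = c \<bullet> e"
proof -
  have "(V *\<^sub>v c) \<bullet> (V *\<^sub>v e) = c \<bullet> (transpose_mat V *\<^sub>v (V *\<^sub>v e))"
    using V c by (intro scalar_prod_mult_mat_vec) auto
  also have "transpose_mat V *\<^sub>v (V *\<^sub>v e) = (transpose_mat V * V) *\<^sub>v e"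
    using V c by (simp add: assoc_mult_mat_vec[of _ m N _ m])
  finally show ?thesis using o c by simp
qed

lemma orthonormal_cols_inj:
  fixes V :: "real mat"
  assumes V: "V \<in> carrier_mat N m" and o: "transpose_mat V * V = 1\<^sub>m m"
    and c: "c \<in> carrier_vec m" "V *\<^sub>v c = 0\<^sub>v N"
  shows "c = 0\<^sub>v m"
  using orthonormal_cols_isometry[OF V o c(1) c(1)] c scalar_prod_self_eq_0[of c m] by simp

lemma orthonormal_cols_iff:
  fixes V :: "real mat"
  assumes V: "V \<in> carrier_mat N m"
  shows "transpose_mat V * V = 1\<^sub>m m \<longleftrightarrow>
    (\<forall>i<m. \<forall>j<m. col V i \<bullet> col V j = (if i = j then 1 else 0))"
proof
  assume "transpose_mat V * V = 1\<^sub>m m"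
  hence "\<And>i j. i < m \<Longrightarrow> j < m \<Longrightarrow> (transpose_mat V * V) $$ (i, j) = 1\<^sub>m m $$ (i, j)" by simp
  thus "\<forall>i<m. \<forall>j<m. col V i \<bullet> col V j = (if i = j then 1 else 0)" using V by auto
qed (use V in \<open>intro eq_matI, auto\<close>)

text \<open>One Gram-Schmidt step: the entries of \<open>transpose_mat V *\<^sub>v r\<close> are the
  scalar products of \<open>r\<close> with the columns of \<open>V\<close>, so \<open>r\<close> is
  orthogonal to all of them and only has to be normalised.\<close>

lemma orthonormal_cols_extend:
  fixes V :: "real mat"
  assumes V: "V \<in> carrier_mat N m" and o: "transpose_mat V * V = 1\<^sub>m m"
    and r: "r \<in> carrier_vec N" "r \<noteq> 0\<^sub>v N" "transpose_mat V *\<^sub>v r = 0\<^sub>v m"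
  defines "u \<equiv> (1 / sqrt (r \<bullet> r)) \<cdot>\<^sub>v r"
  defines "V' \<equiv> mat N (Suc m) (\<lambda>(i, j). if j < m then V $$ (i, j) else u $ i)"
  shows "transpose_mat V' * V' = 1\<^sub>m (Suc m)"
    and "\<And>j. j < m \<Longrightarrow> col V' j = col V j" and "col V' m = u"
proof -
  have u: "u \<in> carrier_vec N" using r by (simp add: u_def)
  show c1: "col V' j = col V j" if "j < m" for j using that V by (auto simp: V'_def)
  show c2: "col V' m = u" using u by (auto simp: V'_def)
  have rr: "r \<bullet> r > 0"
    using scalar_prod_self_nonneg[of r] scalar_prod_self_eq_0[OF r(1)] r(2) by linarith
  have uu: "u \<bullet> u = 1" using r rr by (simp add: u_def field_simps)
  have Vr: "col V j \<bullet> r = 0" if "j < m" for j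
  proof -
    have "(transpose_mat V *\<^sub>v r) $ j = col V j \<bullet> r" using that V by simp
    thus ?thesis using r(3) that by simp
  qed
  have Vu: "col V j \<bullet> u = 0" "u \<bullet> col V j = 0" if "j < m" for j
  proof -
    show "col V j \<bullet> u = 0" using that Vr[OF that] V r by (simp add: u_def)
    thus "u \<bullet> col V j = 0" using comm_scalar_prod[of u N "col V j"] u V that by simp
  qed
  have V': "V' \<in> carrier_mat N (Suc m)" by (simp add: V'_def)
  show "transpose_mat V' * V' = 1\<^sub>m (Suc m)"
    using o V Vu uu c1 c2 unfolding orthonormal_cols_iff[OF V] orthonormal_cols_iff[OF V']
    by (auto simp: less_Suc_eq)
qed

text \<open>An orthonormal system of vectors of \<open>W\<close> of maximal size spans \<open>W\<close>: otherwise the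
  residual of some vector of \<open>W\<close> would extend it.\<close>

lemma orthonormal_frame_exists:
  assumes W: "is_subspace N W"
  obtains m V where "orthonormal_frame N m W V"
proof -
  define P where "P m \<longleftrightarrow> (\<exists>V. V \<in> carrier_mat N m \<and> transpose_mat V * V = 1\<^sub>m m \<and>
    (\<forall>j<m. col V j \<in> W))" for m
  \<comment> \<open>The matrix without columns starts the search for a maximal system; the bound by
    \<open>N\<close> makes the maximum exist.\<close>
  have "P 0" unfolding P_def by (intro exI[of _ "0\<^sub>m N 0"]) (auto intro!: eq_matI)
  moreover have bound: "P m \<Longrightarrow> m \<le> N" for m
    unfolding P_def using inj_mat_cols_le orthonormal_cols_inj by metis
  ultimately obtain m where m: "P m" and max: "\<And>k. P k \<Longrightarrow> k \<le> m"
    using GreatestI_nat[of P 0 N] Greatest_le_nat[of P _ N] by metis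
  from m obtain V where V: "V \<in> carrier_mat N m" and o: "transpose_mat V * V = 1\<^sub>m m"
    and VW: "\<And>j. j < m \<Longrightarrow> col V j \<in> W"
    unfolding P_def by auto
  have inW: "V *\<^sub>v c \<in> W" if "c \<in> carrier_vec m" for c
    using mult_mat_vec_in_subspace[OF W V VW that] .
  have "w \<in> (\<lambda>c. V *\<^sub>v c) ` carrier_vec m" if w: "w \<in> W" for w
  proof (rule ccontr)
    assume neg: "w \<notin> (\<lambda>c. V *\<^sub>v c) ` carrier_vec m"
    have wc: "w \<in> carrier_vec N" using is_subspaceD(1)[OF W w] .
    \<comment> \<open>\<open>V *\<^sub>v c\<close> is the orthogonal projection of \<open>w\<close>
      to the range of \<open>V\<close>, and \<open>r\<close> is the nonzero residual that extends
      the system.\<close>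
    define c where "c = transpose_mat V *\<^sub>v w"
    define r where "r = w - V *\<^sub>v c"
    have c: "c \<in> carrier_vec m" using V wc by (simp add: c_def)
    have rW: "r \<in> W" unfolding r_def using is_subspace_diff[OF W w inW[OF c]] .
    have r: "r \<in> carrier_vec N" using is_subspaceD(1)[OF W rW] .
    have r0: "r \<noteq> 0\<^sub>v N"
    proof
      assume r0: "r = 0\<^sub>v N"
      have "w = V *\<^sub>v c"
      proof (rule eq_vecI)
        fix i assume "i < dim_vec (V *\<^sub>v c)"
        hence i: "i < N" using V by simp
        have "r $ i = 0" using r0 i by simp
        thus "w $ i = (V *\<^sub>v c) $ i" using i V unfolding r_def by (simp del: index_mult_mat_vec)
      qed (use V wc in auto)
      thus False using neg c by auto
    qed
    have Vr: "transpose_mat V *\<^sub>v r = 0\<^sub>v m"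
    proof -
      have "transpose_mat V *\<^sub>v (V *\<^sub>v c) = (transpose_mat V * V) *\<^sub>v c"
        using V c by (simp add: assoc_mult_mat_vec[of _ m N _ m])
      hence "transpose_mat V *\<^sub>v (V *\<^sub>v c) = c" using o c by simp
      thus ?thesis
        using mult_minus_distrib_mat_vec[of "transpose_mat V" m N w "V *\<^sub>v c"] V wc c
        unfolding r_def by (simp add: c_def)
    qed
    define V' where "V' = mat N (Suc m) (\<lambda>(i, j). if j < m then V $$ (i, j)
      else ((1 / sqrt (r \<bullet> r)) \<cdot>\<^sub>v r) $ i)"
    note ext = orthonormal_cols_extend[OF V o r r0 Vr, folded V'_def]
    have "col V' j \<in> W" if "j < Suc m" for j
      using that VW is_subspaceD(4)[OF W rW] ext(2,3) by (cases "j = m") auto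
    hence "P (Suc m)" unfolding P_def
      using ext(1) by (intro exI[of _ V']) (auto simp: V'_def)
    thus False using max by fastforce
  qed
  hence "orthonormal_frame N m W V" unfolding orthonormal_frame_def using V o inW by auto
  thus ?thesis by (rule that)
qed

lemma orthonormal_frame_dim:
  assumes "is_subspace N W" "orthonormal_frame N m W V"
  shows "subspace_dim N W = m"
  using assms unfolding orthonormal_frame_def
  by (intro subspace_dim_eqI[OF assms(1), of V]) (auto dest: orthonormal_cols_inj)

text \<open>For the last claim, write \<open>w\<close> as \<open>V *\<^sub>v c\<close> and cancel
  \<open>transpose_mat V * V\<close>.\<close>

lemma orthonormal_frameD:
  assumes "orthonormal_frame N m W V"
  shows "V \<in> carrier_mat N m" "transpose_mat V * V = 1\<^sub>m m"
    and "c \<in> carrier_vec m \<Longrightarrow> V *\<^sub>v c \<in> W" and "j < m \<Longrightarrow> col V j \<in> W"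
    and "w \<in> W \<Longrightarrow> V *\<^sub>v (transpose_mat V *\<^sub>v w) = w"
proof -
  show V: "V \<in> carrier_mat N m" and o: "transpose_mat V * V = 1\<^sub>m m"
    using assms by (auto simp: orthonormal_frame_def)
  show in_W: "V *\<^sub>v c \<in> W" if "c \<in> carrier_vec m" for c
    using that assms by (auto simp: orthonormal_frame_def)
  show "col V j \<in> W" if "j < m"
    using in_W[of "unit_vec m j"] mat_mult_unit_vec_eq_col[OF V that] by simp
  show "V *\<^sub>v (transpose_mat V *\<^sub>v w) = w" if w: "w \<in> W"
  proof -
    obtain c where c: "c \<in> carrier_vec m" "w = V *\<^sub>v c"
      using w assms by (auto simp: orthonormal_frame_def)
    have "transpose_mat V *\<^sub>v (V *\<^sub>v c) = (transpose_mat V * V) *\<^sub>v c"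
      using V c by (simp add: assoc_mult_mat_vec[of _ m N _ m])
    thus ?thesis using o c by simp
  qed
qed

section \<open>Orthogonal projections and residuals\<close>

text \<open>\<open>V * transpose_mat V\<close> is symmetric and fixes \<open>W\<close>, so moving it
  across the scalar product with \<open>w\<close> makes it disappear.\<close>

lemma orthonormal_frame_proj:
  assumes W: "is_subspace N W" and fr: "orthonormal_frame N m W V" and v: "v \<in> carrier_vec N"
  shows "(V * transpose_mat V) *\<^sub>v v \<in> W"
    and "w \<in> W \<Longrightarrow> (v - (V * transpose_mat V) *\<^sub>v v) \<bullet> w = 0"
proof -
  note V = orthonormal_frameD[OF fr]
  let ?P = "V * transpose_mat V"
  have mv: "?P *\<^sub>v v = V *\<^sub>v (transpose_mat V *\<^sub>v v)"
    using V v by (simp add: assoc_mult_mat_vec[of _ N m _ N])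
  show PW: "?P *\<^sub>v v \<in> W" unfolding mv using V(1) v by (intro V(3)) simp
  show "(v - ?P *\<^sub>v v) \<bullet> w = 0" if w: "w \<in> W"
  proof -
    have wc: "w \<in> carrier_vec N" using is_subspaceD(1)[OF W w] .
    have "(?P *\<^sub>v v) \<bullet> w = (transpose_mat V *\<^sub>v v) \<bullet> (transpose_mat V *\<^sub>v w)"
      unfolding mv using V v wc by (intro scalar_prod_mult_mat_vec) auto
    also have "\<dots> = v \<bullet> (V *\<^sub>v (transpose_mat V *\<^sub>v w))"
      using scalar_prod_mult_mat_vec[of "transpose_mat V" m N v "transpose_mat V *\<^sub>v w"] V v wc by simp
    also have "\<dots> = v \<bullet> w" using V(5)[OF w] by simp
    finally show ?thesis
      using minus_scalar_prod_distrib[OF v is_subspaceD(1)[OF W PW] wc] by simp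
  qed
qed

text \<open>Resolves the definite description: existence is the previous lemma, and uniqueness holds
  because two candidates agree on every vector, in particular on the unit vectors.\<close>

lemma proj_mat_eq:
  assumes W: "is_subspace N W" and fr: "orthonormal_frame N m W V"
  shows "proj_mat N W = V * transpose_mat V"
  unfolding proj_mat_def
proof (rule the_equality)
  note V = orthonormal_frameD[OF fr]
  let ?P = "V * transpose_mat V"
  have P: "?P \<in> carrier_mat N N" "\<And>v. v \<in> carrier_vec N \<Longrightarrow> ?P *\<^sub>v v \<in> W"
    using V(1) orthonormal_frame_proj(1)[OF W fr] by auto
  note orth = orthonormal_frame_proj(2)[OF W fr]
  show "?P \<in> carrier_mat N N \<and> (\<forall>v\<in>carrier_vec N. ?P *\<^sub>v v \<in> W \<and> (\<forall>w\<in>W. (v - ?P *\<^sub>v v) \<bullet> w = 0))"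
    using P orth by auto
  fix Q assume Q: "Q \<in> carrier_mat N N \<and>
    (\<forall>v\<in>carrier_vec N. Q *\<^sub>v v \<in> W \<and> (\<forall>w\<in>W. (v - Q *\<^sub>v v) \<bullet> w = 0))"
  have eq: "Q *\<^sub>v v = ?P *\<^sub>v v" if v: "v \<in> carrier_vec N" for v
  proof -
    define q p where "q = Q *\<^sub>v v" and "p = ?P *\<^sub>v v"
    have qp: "q \<in> W" "p \<in> W" using Q P v by (auto simp: q_def p_def)
    have c: "q \<in> carrier_vec N" "p \<in> carrier_vec N" using qp is_subspaceD(1)[OF W] by auto
    have dW: "p - q \<in> W" using is_subspace_diff[OF W qp(2,1)] .
    have dc: "p - q \<in> carrier_vec N" using c by auto
    \<comment> \<open>Subtracting the two orthogonality relations shows that \<open>p - q\<close>,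
      itself in \<open>W\<close>, is orthogonal to itself.\<close>
    have "(v - q) \<bullet> (p - q) = 0" "(v - p) \<bullet> (p - q) = 0"
      using Q orth v dW by (auto simp: q_def p_def)
    hence "(p - q) \<bullet> (p - q) = 0"
      using minus_scalar_prod_distrib[OF v c(1) dc] minus_scalar_prod_distrib[OF v c(2) dc]
        minus_scalar_prod_distrib[OF c(2) c(1) dc] by simp
    hence d0: "p - q = 0\<^sub>v N" using scalar_prod_self_eq_0[OF dc] by simp
    have "q = p"
    proof (rule eq_vecI)
      fix i assume "i < dim_vec p"
      hence "i < N" using c by simp
      moreover have "(p - q) $ i = 0" using d0 \<open>i < N\<close> by simp
      ultimately show "q $ i = p $ i" using c by simp
    qed (use c in auto)
    thus ?thesis by (simp add: p_def q_def)
  qed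
  show "Q = ?P"
  proof (rule mat_col_eqI)
    show "dim_row Q = dim_row ?P" "dim_col Q = dim_col ?P" using Q P by auto
    fix j assume "j < dim_col ?P"
    hence "j < N" using V by simp
    thus "col Q j = col ?P j"
      using eq[of "unit_vec N j"] mat_mult_unit_vec_eq_col[of Q N N j]
        mat_mult_unit_vec_eq_col[of ?P N N j] Q P by simp
  qed
qed

lemma proj_mat_carrier:
  assumes W: "is_subspace N W"
  shows "proj_mat N W \<in> carrier_mat N N"
proof -
  obtain m V where fr: "orthonormal_frame N m W V" using orthonormal_frame_exists[OF W] .
  show ?thesis using proj_mat_eq[OF W fr] orthonormal_frameD(1)[OF fr] by simp
qed

lemma proj_mat_mult_vec:
  assumes W: "is_subspace N W" and v: "v \<in> carrier_vec N"
  shows "proj_mat N W *\<^sub>v v \<in> W" and "w \<in> W \<Longrightarrow> (v - proj_mat N W *\<^sub>v v) \<bullet> w = 0"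
proof -
  obtain m V where fr: "orthonormal_frame N m W V" using orthonormal_frame_exists[OF W] .
  show "proj_mat N W *\<^sub>v v \<in> W" "w \<in> W \<Longrightarrow> (v - proj_mat N W *\<^sub>v v) \<bullet> w = 0"
    using orthonormal_frame_proj[OF W fr v] unfolding proj_mat_eq[OF W fr] by auto
qed

text \<open>\<open>v - p\<close> is orthogonal to \<open>p - z\<close>, which lies in
  \<open>W\<close>. Hence any \<open>z\<close> in \<open>W\<close> yields an upper bound for the
  squared distance of \<open>v\<close> to \<open>W\<close>.\<close>

lemma proj_mat_pythagoras:
  assumes W: "is_subspace N W" and v: "v \<in> carrier_vec N" and z: "z \<in> W"
  defines "p \<equiv> proj_mat N W *\<^sub>v v"
  shows "(v - z) \<bullet> (v - z) = (v - p) \<bullet> (v - p) + (p - z) \<bullet> (p - z)"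
proof -
  have p: "p \<in> W" unfolding p_def by (rule proj_mat_mult_vec(1)[OF W v])
  have pc: "p \<in> carrier_vec N" and zc: "z \<in> carrier_vec N"
    using p z is_subspaceD(1)[OF W] by auto
  have "(v - p) \<bullet> (p - z) = 0"
    using proj_mat_mult_vec(2)[OF W v is_subspace_diff[OF W p z]] by (simp add: p_def)
  moreover have "p \<bullet> v = v \<bullet> p" "z \<bullet> v = v \<bullet> z" "z \<bullet> p = p \<bullet> z"
    by (rule comm_scalar_prod; fact)+
  ultimately show ?thesis
    using v pc zc by (simp add: minus_scalar_prod_distrib[of _ N] scalar_prod_minus_distrib[of _ N])
qed

text \<open>Both equations express that \<open>v - p\<close> is orthogonal to \<open>p\<close>; they
  turn the diagonal terms of a trace into squared distances.\<close>

lemma proj_mat_residual: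
  assumes W: "is_subspace N W" and v: "v \<in> carrier_vec N"
  defines "p \<equiv> proj_mat N W *\<^sub>v v"
  shows "(v - p) \<bullet> (v - p) = v \<bullet> v - v \<bullet> p" and "v \<bullet> p = p \<bullet> p"
proof -
  have p: "p \<in> W" unfolding p_def by (rule proj_mat_mult_vec(1)[OF W v])
  have pc: "p \<in> carrier_vec N" using p is_subspaceD(1)[OF W] by auto
  have "(v - p) \<bullet> p = 0"
    using proj_mat_mult_vec(2)[OF W v p] by (simp add: p_def)
  moreover have "p \<bullet> v = v \<bullet> p" by (rule comm_scalar_prod[OF pc v])
  ultimately show "(v - p) \<bullet> (v - p) = v \<bullet> v - v \<bullet> p" "v \<bullet> p = p \<bullet> p"
    using v pc by (simp_all add: minus_scalar_prod_distrib[of _ N] scalar_prod_minus_distrib[of _ N])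
qed

section \<open>Affinity as a sum of squared distances\<close>

lemma mat_trace_comm:
  assumes "A \<in> carrier_mat n m" "B \<in> carrier_mat m n"
  shows "mat_trace (A * B) = mat_trace (B * A)"
proof -
  have "mat_trace (A * B) = (\<Sum>i<n. \<Sum>j<m. A $$ (i, j) * B $$ (j, i))"
    using assms by (simp add: mat_trace_def scalar_prod_def lessThan_atLeast0)
  also have "\<dots> = (\<Sum>j<m. \<Sum>i<n. B $$ (j, i) * A $$ (i, j))"
    by (subst sum.swap) (simp add: mult.commute)
  also have "\<dots> = mat_trace (B * A)"
    using assms by (simp add: mat_trace_def scalar_prod_def lessThan_atLeast0)
  finally show ?thesis .
qed

text \<open>If the columns of \<open>V\<close> are an orthonormal basis of a subspace whose
  dimension is at most that of \<open>W\<close>, this is the sum of the squared sines of the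
  principal angles.\<close>

definition sq_dist_sum :: "nat \<Rightarrow> real mat \<Rightarrow> real vec set \<Rightarrow> real" where
  "sq_dist_sum N V W = (\<Sum>j<dim_col V. (col V j - proj_mat N W *\<^sub>v col V j) \<bullet>
     (col V j - proj_mat N W *\<^sub>v col V j))"

text \<open>Cyclicity moves the trace to \<open>transpose_mat V * proj_mat N B * V\<close>, whose
  diagonal entries are 1 minus the squared distances of the unit columns to
  \<open>B\<close>.\<close>

lemma aff_sq_frame:
  assumes A: "is_subspace N A" and B: "is_subspace N B" and fr: "orthonormal_frame N m A V"
  shows "(aff N A B)\<^sup>2 = real m - sq_dist_sum N V B"
proof -
  note V = orthonormal_frameD[OF fr]
  let ?P = "proj_mat N B"
  have P: "?P \<in> carrier_mat N N" by (rule proj_mat_carrier[OF B])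
  have cc: "col V j \<in> carrier_vec N" for j using V(1) by auto
  have "mat_trace (proj_mat N A * ?P) = mat_trace (V * (transpose_mat V * ?P))"
    using V(1) P by (simp add: proj_mat_eq[OF A fr] assoc_mult_mat[of _ N m _ N _ N])
  also have "\<dots> = mat_trace (transpose_mat V * ?P * V)"
    using V(1) P by (intro mat_trace_comm) auto
  also have "\<dots> = mat_trace (transpose_mat V * (?P * V))"
    using V(1) P by (simp add: assoc_mult_mat[of _ m N _ N _ m])
  also have "\<dots> = (\<Sum>j<m. col V j \<bullet> (?P *\<^sub>v col V j))"
    using V(1) P by (simp add: mat_trace_def mult_mat_vec_def)
  finally have tr: "mat_trace (proj_mat N A * ?P) = (\<Sum>j<m. col V j \<bullet> (?P *\<^sub>v col V j))" .
  \<comment> \<open>Squaring undoes \<open>sqrt\<close> only on nonnegative numbers; here each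
    summand is the squared norm of a projection.\<close>
  have "\<dots> \<ge> 0"
    using proj_mat_residual(2)[OF B cc] scalar_prod_self_nonneg by (auto intro!: sum_nonneg)
  hence "(aff N A B)\<^sup>2 = (\<Sum>j<m. col V j \<bullet> (?P *\<^sub>v col V j))"
    by (simp add: aff_def tr)
  also have "\<dots> = (\<Sum>j<m. 1 - (col V j - ?P *\<^sub>v col V j) \<bullet> (col V j - ?P *\<^sub>v col V j))"
    using proj_mat_residual(1)[OF B cc] V(2)
    by (intro sum.cong) (auto simp: orthonormal_cols_iff[OF V(1)])
  also have "\<dots> = real m - sq_dist_sum N V B"
    using V(1) by (simp add: sq_dist_sum_def sum_subtractf)
  finally show ?thesis .
qed

section \<open>Frobenius norms and the comparison of distance sums\<close>

lemma sum_cols_eq_sum_rows: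
  fixes Q :: "real mat"
  assumes "Q \<in> carrier_mat n m"
  shows "(\<Sum>j<m. col Q j \<bullet> col Q j) = (\<Sum>i<n. row Q i \<bullet> row Q i)"
  using assms by (simp add: scalar_prod_def lessThan_atLeast0[symmetric]) (rule sum.swap)

lemma transpose_norm_bound:
  fixes K :: "real mat"
  assumes K: "K \<in> carrier_mat n m" and a: "a > 0"
    and bound: "\<And>c. c \<in> carrier_vec m \<Longrightarrow> (K *\<^sub>v c) \<bullet> (K *\<^sub>v c) \<le> a * (c \<bullet> c)"
    and y: "y \<in> carrier_vec n"
  shows "(transpose_mat K *\<^sub>v y) \<bullet> (transpose_mat K *\<^sub>v y) \<le> a * (y \<bullet> y)"
proof -
  define c where "c = transpose_mat K *\<^sub>v y"
  have c: "c \<in> carrier_vec m" using K y by (simp add: c_def)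
  define z where "z = K *\<^sub>v c"
  have z: "z \<in> carrier_vec n" using K c by (simp add: z_def)
  have zy: "z \<bullet> y = c \<bullet> c" "y \<bullet> z = c \<bullet> c"
  proof -
    show "z \<bullet> y = c \<bullet> c"
      unfolding z_def using scalar_prod_mult_mat_vec[OF K c y] by (simp add: c_def)
    thus "y \<bullet> z = c \<bullet> c" using comm_scalar_prod[OF y z] by simp
  qed
  \<comment> \<open>Expanding \<open>\<parallel>a y - K K\<^sup>T y\<parallel>\<^sup>2 \<ge> 0\<close> gives the claim without Cauchy-Schwarz.\<close>
  have "0 \<le> (a \<cdot>\<^sub>v y - z) \<bullet> (a \<cdot>\<^sub>v y - z)" by (rule scalar_prod_self_nonneg)
  also have "\<dots> = a * a * (y \<bullet> y) - 2 * a * (c \<bullet> c) + z \<bullet> z"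
    using y z zy by (simp add: minus_scalar_prod_distrib[of _ n] scalar_prod_minus_distrib[of _ n]
      algebra_simps)
  also have "\<dots> \<le> a * (a * (y \<bullet> y) - c \<bullet> c)"
    using bound[OF c] by (simp add: z_def algebra_simps)
  finally show ?thesis using a by (simp add: zero_le_mult_iff c_def)
qed

text \<open>Summing by rows instead of columns reduces the claim to single rows: each row of
  \<open>Q * K\<close> is \<open>transpose_mat K\<close> applied to a row of \<open>Q\<close>, and
  the transpose obeys the same norm bound.\<close>

lemma frobenius_mult_le:
  fixes Q K :: "real mat"
  assumes Q: "Q \<in> carrier_mat N n" and K: "K \<in> carrier_mat n m" and a: "a > 0"
    and bound: "\<And>c. c \<in> carrier_vec m \<Longrightarrow> (K *\<^sub>v c) \<bullet> (K *\<^sub>v c) \<le> a * (c \<bullet> c)"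
  shows "(\<Sum>j<m. col (Q * K) j \<bullet> col (Q * K) j) \<le> a * (\<Sum>j<n. col Q j \<bullet> col Q j)"
proof -
  have QK: "Q * K \<in> carrier_mat N m" using Q K by simp
  have row: "row (Q * K) i = transpose_mat K *\<^sub>v row Q i" if "i < N" for i
    using that Q K by (intro eq_vecI) (auto intro!: comm_scalar_prod[of _ n])
  have "(\<Sum>j<m. col (Q * K) j \<bullet> col (Q * K) j) = (\<Sum>i<N. row (Q * K) i \<bullet> row (Q * K) i)"
    by (rule sum_cols_eq_sum_rows[OF QK])
  also have "\<dots> \<le> (\<Sum>i<N. a * (row Q i \<bullet> row Q i))"
  proof (intro sum_mono)
    fix i assume "i \<in> {..<N}"
    thus "row (Q * K) i \<bullet> row (Q * K) i \<le> a * (row Q i \<bullet> row Q i)"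
      using transpose_norm_bound[OF K a bound, of "row Q i"] row Q by auto
  qed
  also have "\<dots> = a * (\<Sum>j<n. col Q j \<bullet> col Q j)"
    by (simp add: sum_distrib_left sum_cols_eq_sum_rows[OF Q])
  finally show ?thesis .
qed

lemma sq_dist_sum_nonneg: "sq_dist_sum N V W \<ge> 0"
  unfolding sq_dist_sum_def by (intro sum_nonneg scalar_prod_self_nonneg)

text \<open>Combines two losses: \<open>a\<close> for replacing the frame \<open>U\<close> by the
  columns of \<open>A\<close>, and \<open>b\<close> for passing from distances to \<open>S2\<close>
  to distances to \<open>T2\<close>. The abstract form allows one use for a map and one for its
  inverse.\<close>

lemma sq_dist_sum_transfer:
  assumes S: "is_subspace N S1" "is_subspace N S2" and T2: "is_subspace p T2"
    and V: "V \<in> carrier_mat p m" and fr: "orthonormal_frame N k S1 U"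
    and A: "A \<in> carrier_mat N m" "\<And>j. j < m \<Longrightarrow> col A j \<in> S1"
    and a: "a > 0" "\<And>c. c \<in> carrier_vec m \<Longrightarrow> (A *\<^sub>v c) \<bullet> (A *\<^sub>v c) \<le> a * (c \<bullet> c)"
    and b: "b \<ge> 0" "\<And>j. j < m \<Longrightarrow> \<exists>z\<in>T2. (col V j - z) \<bullet> (col V j - z) \<le>
      b * ((col A j - proj_mat N S2 *\<^sub>v col A j) \<bullet> (col A j - proj_mat N S2 *\<^sub>v col A j))"
  shows "sq_dist_sum p V T2 \<le> a * b * sq_dist_sum N U S2"
proof -
  note U = orthonormal_frameD[OF fr]
  define P where "P = proj_mat N S2"
  have P: "P \<in> carrier_mat N N" unfolding P_def by (rule proj_mat_carrier[OF S(2)])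
  \<comment> \<open>\<open>Q\<close> collects the residuals of the frame and \<open>K\<close> the
    coordinates of the columns of \<open>A\<close> in it, so \<open>Q * K\<close> collects the
    residuals of the columns of \<open>A\<close>. As \<open>U\<close> is an isometry,
    \<open>K\<close> inherits the bound \<open>a\<close>.\<close>
  define Q where "Q = U - P * U"
  define K where "K = transpose_mat U * A"
  have Q: "Q \<in> carrier_mat N k" using U(1) P by (auto simp: Q_def)
  have K: "K \<in> carrier_mat k m" using U(1) A by (simp add: K_def)
  have UK: "U * K = A"
  proof (rule mat_col_eqI)
    fix j assume "j < dim_col A"
    hence j: "j < m" using A by simp
    have "col (U * K) j = U *\<^sub>v (transpose_mat U *\<^sub>v col A j)"
      using col_mult2[OF U(1) K j] col_mult2[of "transpose_mat U" k N A m j] U(1) A(1) j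
      by (simp add: K_def)
    thus "col (U * K) j = col A j" using U(5)[OF A(2)[OF j]] by simp
  qed (use U(1) A K in auto)
  have QK: "col (Q * K) j = col A j - P *\<^sub>v col A j" if j: "j < m" for j
  proof -
    have "Q * K = A - P * A"
      using minus_mult_distrib_mat[of U N k "P * U" K m] U(1) P K UK
      by (simp add: Q_def assoc_mult_mat[of _ N N _ k _ m])
    thus ?thesis using j A P by (intro eq_vecI) auto
  qed
  have colQ: "col Q j = col U j - P *\<^sub>v col U j" if j: "j < k" for j
    using j U(1) P by (intro eq_vecI) (auto simp: Q_def)
  have Kbound: "(K *\<^sub>v c) \<bullet> (K *\<^sub>v c) \<le> a * (c \<bullet> c)" if c: "c \<in> carrier_vec m" for c
  proof -
    have "(K *\<^sub>v c) \<bullet> (K *\<^sub>v c) = (U *\<^sub>v (K *\<^sub>v c)) \<bullet> (U *\<^sub>v (K *\<^sub>v c))"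
      using orthonormal_cols_isometry[OF U(1,2)] K c by simp
    also have "U *\<^sub>v (K *\<^sub>v c) = A *\<^sub>v c"
      using U(1) K c UK by (metis assoc_mult_mat_vec)
    finally show ?thesis using a(2)[OF c] by simp
  qed
  have "sq_dist_sum p V T2 \<le> (\<Sum>j<m. b * (col (Q * K) j \<bullet> col (Q * K) j))"
    unfolding sq_dist_sum_def carrier_matD(2)[OF V]
  proof (intro sum_mono)
    fix j assume "j \<in> {..<m}"
    hence j: "j < m" by simp
    obtain z where z: "z \<in> T2" and le: "(col V j - z) \<bullet> (col V j - z) \<le>
        b * ((col A j - P *\<^sub>v col A j) \<bullet> (col A j - P *\<^sub>v col A j))"
      using b(2)[OF j] by (auto simp: P_def)
    have "col V j \<in> carrier_vec p" using V by auto
    \<comment> \<open>The projection to \<open>T2\<close> is at least as close to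
      \<open>col V j\<close> as the given \<open>z\<close>.\<close>
    from proj_mat_pythagoras[OF T2 this z] le
      scalar_prod_self_nonneg[of "proj_mat p T2 *\<^sub>v col V j - z"]
    show "(col V j - proj_mat p T2 *\<^sub>v col V j) \<bullet> (col V j - proj_mat p T2 *\<^sub>v col V j)
      \<le> b * (col (Q * K) j \<bullet> col (Q * K) j)"
      unfolding QK[OF j] by linarith
  qed
  also have "\<dots> \<le> b * (a * (\<Sum>j<k. col Q j \<bullet> col Q j))"
    unfolding sum_distrib_left[symmetric]
    by (intro mult_left_mono b(1) frobenius_mult_le[OF Q K a(1) Kbound])
  also have "(\<Sum>j<k. col Q j \<bullet> col Q j) = sq_dist_sum N U S2"
    unfolding sq_dist_sum_def using U(1) colQ by (auto simp: P_def intro!: sum.cong)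
  finally show ?thesis by (simp add: mult_ac)
qed

section \<open>Singular values as norm bounds\<close>

lemma euclid_norm_sq: "(euclid_norm x)\<^sup>2 = x \<bullet> x"
  by (simp add: euclid_norm_def scalar_prod_self_nonneg)

text \<open>Entries of a unit vector have absolute value at most 1, so each entry of the image is
  bounded by an absolute row sum. Boundedness is what makes the supremum in \<open>s_max\<close> an
  upper bound.\<close>

lemma mat_mult_unit_sphere_bounded:
  fixes M :: "real mat"
  shows "bdd_above ((\<lambda>x. euclid_norm (M *\<^sub>v x)) ` {x \<in> carrier_vec (dim_col M). euclid_norm x = 1})"
proof (rule bdd_aboveI2)
  fix x assume x: "x \<in> {x \<in> carrier_vec (dim_col M). euclid_norm x = 1}"
  have xx: "x \<bullet> x = 1" using x euclid_norm_sq[of x] by simp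
  have entry: "\<bar>x $ j\<bar> \<le> 1" if "j < dim_col M" for j
  proof -
    have "x $ j * x $ j \<le> (\<Sum>i\<in>{0..<dim_col M}. x $ i * x $ i)"
      using that by (intro member_le_sum) auto
    also have "\<dots> = 1" using xx x by (auto simp: scalar_prod_def)
    finally have "(x $ j)\<^sup>2 \<le> 1" by (simp add: power2_eq_square)
    thus ?thesis using abs_square_le_1 by blast
  qed
  have "(M *\<^sub>v x) \<bullet> (M *\<^sub>v x) = (\<Sum>i<dim_row M. ((M *\<^sub>v x) $ i)\<^sup>2)"
    by (simp add: scalar_prod_def lessThan_atLeast0 power2_eq_square)
  also have "\<dots> \<le> (\<Sum>i<dim_row M. (\<Sum>j<dim_col M. \<bar>M $$ (i, j)\<bar>)\<^sup>2)"
  proof (intro sum_mono)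
    fix i assume i: "i \<in> {..<dim_row M}"
    have "\<bar>(M *\<^sub>v x) $ i\<bar> = \<bar>\<Sum>j<dim_col M. M $$ (i, j) * x $ j\<bar>"
      using i x by (auto simp: scalar_prod_def lessThan_atLeast0 intro!: arg_cong[of _ _ abs] sum.cong)
    also have "\<dots> \<le> (\<Sum>j<dim_col M. \<bar>M $$ (i, j) * x $ j\<bar>)" by (rule sum_abs)
    also have "\<dots> \<le> (\<Sum>j<dim_col M. \<bar>M $$ (i, j)\<bar>)"
      using entry by (intro sum_mono) (auto simp: abs_mult intro!: mult_left_le)
    finally show "((M *\<^sub>v x) $ i)\<^sup>2 \<le> (\<Sum>j<dim_col M. \<bar>M $$ (i, j)\<bar>)\<^sup>2"
      by (metis abs_ge_zero power2_abs power_mono)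
  qed
  finally show "euclid_norm (M *\<^sub>v x) \<le> sqrt (\<Sum>i<dim_row M. (\<Sum>j<dim_col M. \<bar>M $$ (i, j)\<bar>)\<^sup>2)"
    unfolding euclid_norm_def by (rule real_sqrt_le_mono)
qed

text \<open>Scale a nonzero \<open>c\<close> to the unit sphere and scale the estimate back.\<close>

lemma singular_value_bounds:
  fixes M :: "real mat"
  assumes M: "M \<in> carrier_mat n d" and c: "c \<in> carrier_vec d"
  shows "(s_min M)\<^sup>2 * (c \<bullet> c) \<le> (M *\<^sub>v c) \<bullet> (M *\<^sub>v c)"
    and "(M *\<^sub>v c) \<bullet> (M *\<^sub>v c) \<le> (s_max M)\<^sup>2 * (c \<bullet> c)"
proof -
  have "(s_min M)\<^sup>2 * (c \<bullet> c) \<le> (M *\<^sub>v c) \<bullet> (M *\<^sub>v c) \<and>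
    (M *\<^sub>v c) \<bullet> (M *\<^sub>v c) \<le> (s_max M)\<^sup>2 * (c \<bullet> c)"
  proof (cases "c = 0\<^sub>v d")
    \<comment> \<open>This case covers \<open>d = 0\<close>, where \<open>s_min\<close> and
      \<open>s_max\<close> are unspecified but the zero vector is the only one.\<close>
    case True
    have "M *\<^sub>v c = 0\<^sub>v n" using True M by auto
    thus ?thesis using True by simp
  next
    case False
    let ?S = "{x \<in> carrier_vec (dim_col M). euclid_norm x = 1}"
    have pos: "c \<bullet> c > 0"
      using scalar_prod_self_nonneg[of c] scalar_prod_self_eq_0[OF c] False by linarith
    define t where "t = 1 / sqrt (c \<bullet> c)"
    have t: "t * t * (c \<bullet> c) = 1" using pos by (simp add: t_def field_simps)
    define x where "x = t \<cdot>\<^sub>v c"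
    have x: "x \<in> ?S"
    proof -
      have "x \<bullet> x = 1" using t c by (simp add: x_def mult_ac)
      thus ?thesis using c M by (simp add: x_def euclid_norm_def)
    qed
    have low: "s_min M \<le> euclid_norm (M *\<^sub>v x)"
      unfolding s_min_def using x
      by (intro cINF_lower bdd_belowI2[of _ 0]) (auto simp: euclid_norm_def scalar_prod_self_nonneg)
    \<comment> \<open>Nonnegativity is required for squaring the lower estimate; \<open>x\<close>
      shows that the infimum is over a nonempty set.\<close>
    have "0 \<le> s_min M"
      unfolding s_min_def using x
      by (intro cINF_greatest) (auto simp: euclid_norm_def scalar_prod_self_nonneg)
    with low have low2: "(s_min M)\<^sup>2 \<le> (euclid_norm (M *\<^sub>v x))\<^sup>2" by (intro power_mono) auto
    have up: "euclid_norm (M *\<^sub>v x) \<le> s_max M"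
      unfolding s_max_def using x by (intro cSUP_upper mat_mult_unit_sphere_bounded)
    hence up2: "(euclid_norm (M *\<^sub>v x))\<^sup>2 \<le> (s_max M)\<^sup>2"
      by (intro power_mono) (auto simp: euclid_norm_def scalar_prod_self_nonneg)
    have Mx: "(euclid_norm (M *\<^sub>v x))\<^sup>2 = t * t * ((M *\<^sub>v c) \<bullet> (M *\<^sub>v c))"
      unfolding euclid_norm_sq using M c by (simp add: x_def mult_mat_vec[OF M c] mult_ac)
    have "(M *\<^sub>v c) \<bullet> (M *\<^sub>v c) = (euclid_norm (M *\<^sub>v x))\<^sup>2 * (c \<bullet> c)"
      unfolding Mx using t by (metis mult.assoc mult.commute mult_1)
    thus ?thesis using low2 up2 pos by (simp add: mult_right_mono)
  qed
  thus "(s_min M)\<^sup>2 * (c \<bullet> c) \<le> (M *\<^sub>v c) \<bullet> (M *\<^sub>v c)"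
    "(M *\<^sub>v c) \<bullet> (M *\<^sub>v c) \<le> (s_max M)\<^sup>2 * (c \<bullet> c)" by auto
qed

text \<open>Write \<open>x\<close> as \<open>U *\<^sub>v c\<close>: the isometry \<open>U\<close>
  preserves the norm of \<open>c\<close>, and \<open>F\<close> acts on \<open>x\<close> as
  \<open>F * U\<close> acts on \<open>c\<close>.\<close>

lemma restricted_isometry:
  assumes W: "is_subspace N X" and U: "U \<in> carrier_mat N d" and onb: "orthonormal_basis_cols N X U"
    and F: "F \<in> carrier_mat n N" and x: "x \<in> X"
  shows "(s_min (F * U))\<^sup>2 * (x \<bullet> x) \<le> (F *\<^sub>v x) \<bullet> (F *\<^sub>v x)"
    and "(F *\<^sub>v x) \<bullet> (F *\<^sub>v x) \<le> (s_max (F * U))\<^sup>2 * (x \<bullet> x)"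
proof -
  note R = orthonormal_basis_cols_range[OF W U onb]
  obtain c where c: "c \<in> carrier_vec d" "x = U *\<^sub>v c" using R(2) x by auto
  have xx: "x \<bullet> x = c \<bullet> c" using orthonormal_cols_isometry[OF U R(1) c(1) c(1)] c(2) by simp
  have Fx: "F *\<^sub>v x = (F * U) *\<^sub>v c" using F U c by simp
  show "(s_min (F * U))\<^sup>2 * (x \<bullet> x) \<le> (F *\<^sub>v x) \<bullet> (F *\<^sub>v x)"
    "(F *\<^sub>v x) \<bullet> (F *\<^sub>v x) \<le> (s_max (F * U))\<^sup>2 * (x \<bullet> x)"
    unfolding xx Fx using singular_value_bounds[OF _ c(1), of "F * U" n] F U by auto
qed

section \<open>Affinity under a near-isometry\<close>

lemma aff_sq_near_isometry:
  assumes X: "is_subspace N X" "is_subspace N X1" "X1 \<subseteq> X" "is_subspace N X2" "X2 \<subseteq> X"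
    and F: "F \<in> carrier_mat n N" and d1: "subspace_dim N X1 = d1"
    and \<delta>: "0 < \<delta>" "\<delta> < 1 / 4"
    and lo: "\<And>x. x \<in> X \<Longrightarrow> (1 - \<delta>) * (x \<bullet> x) \<le> (F *\<^sub>v x) \<bullet> (F *\<^sub>v x)"
    and up: "\<And>x. x \<in> X \<Longrightarrow> (F *\<^sub>v x) \<bullet> (F *\<^sub>v x) \<le> (1 + \<delta>) * (x \<bullet> x)"
  defines "Y1 \<equiv> (\<lambda>x. F *\<^sub>v x) ` X1" and "Y2 \<equiv> (\<lambda>x. F *\<^sub>v x) ` X2"
  shows "\<bar>(aff n Y1 Y2)\<^sup>2 - (aff N X1 X2)\<^sup>2\<bar> \<le> 3 * (real d1 - (aff N X1 X2)\<^sup>2) * \<delta>"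
proof -
  have Y: "is_subspace n Y1" "is_subspace n Y2"
    unfolding Y1_def Y2_def using is_subspace_image[OF _ F] X by auto
  have Xc: "x \<in> carrier_vec N" if "x \<in> X" for x using is_subspaceD(1)[OF X(1) that] .
  have lo': "x \<bullet> x \<le> 1 / (1 - \<delta>) * ((F *\<^sub>v x) \<bullet> (F *\<^sub>v x))" if "x \<in> X" for x
    using lo[OF that] \<delta> by (simp add: field_simps)
  have diff: "F *\<^sub>v (x - y) = F *\<^sub>v x - F *\<^sub>v y" if "x \<in> X" "y \<in> X" for x y
    using mult_minus_distrib_mat_vec[OF F Xc Xc] that by blast
  obtain k U where fX: "orthonormal_frame N k X1 U" using orthonormal_frame_exists[OF X(2)] .
  have k: "k = d1" using orthonormal_frame_dim[OF X(2) fX] d1 by simp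
  note U = orthonormal_frameD[OF fX[unfolded k]]
  obtain m V where fY: "orthonormal_frame n m Y1 V" using orthonormal_frame_exists[OF Y(1)] .
  note V = orthonormal_frameD[OF fY]
  have FU: "F * U \<in> carrier_mat n d1" using F U by simp
  \<comment> \<open>By \<open>lo'\<close>, \<open>F\<close> is injective on \<open>X\<close>, so
    \<open>X1\<close> and its image have equal dimension. This makes the dimensions cancel when the
    two squared affinities are subtracted.\<close>
  have m: "m = d1"
  proof -
    have "subspace_dim n Y1 = d1"
    proof (rule subspace_dim_eqI[OF Y(1) FU])
      fix c assume c: "c \<in> carrier_vec d1" "(F * U) *\<^sub>v c = 0\<^sub>v n"
      have Uc: "U *\<^sub>v c \<in> X" using U(3)[OF c(1)] X by auto
      have "F *\<^sub>v (U *\<^sub>v c) = 0\<^sub>v n" using c F U by simp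
      hence "(U *\<^sub>v c) \<bullet> (U *\<^sub>v c) \<le> 0" using lo'[OF Uc] by simp
      hence "U *\<^sub>v c = 0\<^sub>v N"
        using scalar_prod_self_nonneg[of "U *\<^sub>v c"] scalar_prod_self_eq_0[OF Xc[OF Uc]] by linarith
      thus "c = 0\<^sub>v d1" using orthonormal_cols_inj[OF U(1,2) c(1)] by simp
    next
      have "(\<lambda>c. (F * U) *\<^sub>v c) ` carrier_vec d1 = (\<lambda>c. F *\<^sub>v (U *\<^sub>v c)) ` carrier_vec d1"
        using F U by (intro image_cong) auto
      also have "\<dots> = Y1"
        using fX unfolding Y1_def orthonormal_frame_def k by (auto simp: image_image)
      finally show "(\<lambda>c. (F * U) *\<^sub>v c) ` carrier_vec d1 = Y1" .
    qed
    thus ?thesis using orthonormal_frame_dim[OF Y(1) fY] by simp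
  qed
  define DX where "DX = sq_dist_sum N U X2"
  define DY where "DY = sq_dist_sum n V Y2"
  have affX: "(aff N X1 X2)\<^sup>2 = real d1 - DX"
    unfolding DX_def using aff_sq_frame[OF X(2,4) fX] k by simp
  have affY: "(aff n Y1 Y2)\<^sup>2 = real d1 - DY"
    unfolding DY_def using aff_sq_frame[OF Y fY] m by simp

  \<comment> \<open>Pull the frame of \<open>Y1\<close> back to \<open>X1\<close>; the preimages
    become the columns of \<open>A\<close>, with \<open>F * A = V\<close>.\<close>
  have "\<exists>w\<in>X1. F *\<^sub>v w = col V j" if "j < d1" for j
    using V(4)[of j] that m by (auto simp: Y1_def)
  then obtain w where w: "\<And>j. j < d1 \<Longrightarrow> w j \<in> X1" "\<And>j. j < d1 \<Longrightarrow> F *\<^sub>v w j = col V j"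
    by metis
  define A where "A = mat_of_cols N (map w [0..<d1])"
  have A: "A \<in> carrier_mat N d1"
    using mat_of_cols_carrier(1)[of N "map w [0..<d1]"] by (simp add: A_def)
  have colA: "col A j = w j" if "j < d1" for j
    using that w(1)[OF that] is_subspaceD(1)[OF X(2)] by (simp add: A_def)
  have colAX: "col A j \<in> X1" if "j < d1" for j using colA w(1) that by simp
  have FA: "F * A = V"
  proof (rule mat_col_eqI)
    fix j assume "j < dim_col V"
    hence j: "j < d1" using V(1) m by simp
    show "col (F * A) j = col V j" using col_mult2[OF F A j] colA w(2) j by simp
  qed (use F A V(1) m in auto)

  \<comment> \<open>The factor \<open>1 / (1 - \<delta>)\<close> bounds the pullback
    \<open>A\<close> of the isometry \<open>V\<close>; the factor \<open>1 + \<delta>\<close> bounds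
    the growth of distances under \<open>F\<close>.\<close>
  have DY_le: "DY \<le> 1 / (1 - \<delta>) * (1 + \<delta>) * DX"
    unfolding DX_def DY_def
  proof (rule sq_dist_sum_transfer[OF X(2,4) Y(2) V(1)[unfolded m] fX[unfolded k] A colAX])
    show "(A *\<^sub>v c) \<bullet> (A *\<^sub>v c) \<le> 1 / (1 - \<delta>) * (c \<bullet> c)" if c: "c \<in> carrier_vec d1" for c
    proof -
      have "A *\<^sub>v c \<in> X" using mult_mat_vec_in_subspace[OF X(2) A colAX c] X by auto
      from lo'[OF this] have "(A *\<^sub>v c) \<bullet> (A *\<^sub>v c) \<le> 1 / (1 - \<delta>) * ((V *\<^sub>v c) \<bullet> (V *\<^sub>v c))"
        using F A c FA by (metis assoc_mult_mat_vec)
      thus ?thesis using orthonormal_cols_isometry[OF V(1,2)] c m by simp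
    qed
    fix j assume j: "j < d1"
    \<comment> \<open>The point of \<open>X2\<close> nearest to \<open>col A j\<close>; its image
      under \<open>F\<close> is the competitor in \<open>Y2\<close>.\<close>
    define z where "z = proj_mat N X2 *\<^sub>v col A j"
    have z: "z \<in> X2" unfolding z_def
      by (intro proj_mat_mult_vec(1)[OF X(4)] Xc) (use colAX[OF j] X in auto)
    have Aj: "col A j \<in> X" "z \<in> X" using colAX[OF j] z X by auto
    have "col V j = F *\<^sub>v col A j" using colA[OF j] w(2)[OF j] by simp
    hence "col V j - F *\<^sub>v z = F *\<^sub>v (col A j - z)" using diff[OF Aj] by simp
    hence "(col V j - F *\<^sub>v z) \<bullet> (col V j - F *\<^sub>v z) \<le> (1 + \<delta>) * ((col A j - z) \<bullet> (col A j - z))"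
      using up[OF is_subspace_diff[OF X(1) Aj]] by simp
    thus "\<exists>z\<in>Y2. (col V j - z) \<bullet> (col V j - z) \<le> (1 + \<delta>) *
      ((col A j - proj_mat N X2 *\<^sub>v col A j) \<bullet> (col A j - proj_mat N X2 *\<^sub>v col A j))"
      using z unfolding Y2_def z_def by blast
  qed (use \<delta> in auto)

  have colFU: "col (F * U) j = F *\<^sub>v col U j" if "j < d1" for j
    using col_mult2[OF F U(1) that] .
  \<comment> \<open>The same comparison for the inverse of \<open>F\<close> on the image of
    \<open>X\<close>: now \<open>F * U\<close> plays the role of \<open>A\<close>, and the two
    factors swap their origins.\<close>
  have DX_le: "DX \<le> (1 + \<delta>) * (1 / (1 - \<delta>)) * DY"
    unfolding DX_def DY_def
  proof (rule sq_dist_sum_transfer[OF Y X(4) U(1) fY FU])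
    show "col (F * U) j \<in> Y1" if "j < d1" for j
      using colFU[OF that] U(4)[OF that] by (simp add: Y1_def)
    show "((F * U) *\<^sub>v c) \<bullet> ((F * U) *\<^sub>v c) \<le> (1 + \<delta>) * (c \<bullet> c)" if c: "c \<in> carrier_vec d1" for c
    proof -
      have "U *\<^sub>v c \<in> X" using U(3)[OF c] X by auto
      from up[OF this] have "((F * U) *\<^sub>v c) \<bullet> ((F * U) *\<^sub>v c) \<le> (1 + \<delta>) * ((U *\<^sub>v c) \<bullet> (U *\<^sub>v c))"
        using F U(1) c by simp
      thus ?thesis using orthonormal_cols_isometry[OF U(1,2) c c] by simp
    qed
    fix j assume j: "j < d1"
    \<comment> \<open>The competitor in \<open>X2\<close> is a preimage of the point of
      \<open>Y2\<close> nearest to \<open>col (F * U) j\<close>.\<close>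
    have "proj_mat n Y2 *\<^sub>v col (F * U) j \<in> Y2"
      by (intro proj_mat_mult_vec(1)[OF Y(2)] carrier_vecI) (use F in simp)
    then obtain z where z: "z \<in> X2" "proj_mat n Y2 *\<^sub>v col (F * U) j = F *\<^sub>v z"
      by (auto simp: Y2_def)
    have Uj: "col U j \<in> X" "z \<in> X" using U(4)[OF j] z X by auto
    show "\<exists>z\<in>X2. (col U j - z) \<bullet> (col U j - z) \<le> 1 / (1 - \<delta>) *
      ((col (F * U) j - proj_mat n Y2 *\<^sub>v col (F * U) j) \<bullet>
       (col (F * U) j - proj_mat n Y2 *\<^sub>v col (F * U) j))"
      using z lo'[OF is_subspace_diff[OF X(1) Uj]] diff[OF Uj] colFU[OF j] by auto
  qed (use \<delta> in auto)

  have DX0: "DX \<ge> 0" unfolding DX_def by (rule sq_dist_sum_nonneg)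
  have "(1 - \<delta>) * DY \<le> (1 + \<delta>) * DX" "(1 - \<delta>) * DX \<le> (1 + \<delta>) * DY"
    using DY_le DX_le \<delta> by (simp_all add: field_simps)
  hence "(1 - \<delta>) * (DY - DX) \<le> 2 * \<delta> * DX" "(1 + \<delta>) * (DX - DY) \<le> 2 * \<delta> * DX"
    by (simp_all add: algebra_simps)
  \<comment> \<open>Here the constant 3 arises: \<open>\<delta> < 1 / 4\<close> gives
    \<open>3 * (1 - \<delta>) > 9 / 4\<close>, which exceeds 2.\<close>
  moreover have "2 * \<delta> * DX \<le> (1 - \<delta>) * (3 * DX * \<delta>)" "2 * \<delta> * DX \<le> (1 + \<delta>) * (3 * DX * \<delta>)"
  proof -
    have "2 * (DX * \<delta>) \<le> (1 - \<delta>) * 3 * (DX * \<delta>)" "2 * (DX * \<delta>) \<le> (1 + \<delta>) * 3 * (DX * \<delta>)"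
      using DX0 \<delta> by (auto intro!: mult_right_mono)
    thus "2 * \<delta> * DX \<le> (1 - \<delta>) * (3 * DX * \<delta>)" "2 * \<delta> * DX \<le> (1 + \<delta>) * (3 * DX * \<delta>)"
      by (simp_all add: mult_ac)
  qed
  ultimately have "(1 - \<delta>) * (DY - DX) \<le> (1 - \<delta>) * (3 * DX * \<delta>)"
    "(1 + \<delta>) * (DX - DY) \<le> (1 + \<delta>) * (3 * DX * \<delta>)" by linarith+
  hence "DY - DX \<le> 3 * DX * \<delta>" "DX - DY \<le> 3 * DX * \<delta>"
    using \<delta> by (simp_all add: mult_le_cancel_left)
  thus ?thesis unfolding affX affY by (simp add: abs_le_iff)
qed

theorem theorem2:
  shows "\<exists>C::real. C > 0 \<and>
    (\<forall>(N::nat) (n::nat) (d::nat) (d1::nat) (d2::nat)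
       (X::real vec set) (X1::real vec set) (X2::real vec set)
       (U::real mat) (\<Phi>::real mat) (\<delta>::real).
       is_subspace N X \<and> subspace_dim N X = d \<and>
       is_subspace N X1 \<and> X1 \<subseteq> X \<and> subspace_dim N X1 = d1 \<and>
       is_subspace N X2 \<and> X2 \<subseteq> X \<and> subspace_dim N X2 = d2 \<and>
       d1 \<le> d2 \<and>
       U \<in> carrier_mat N d \<and> orthonormal_basis_cols N X U \<and>
       \<Phi> \<in> carrier_mat n N \<and>
       0 < \<delta> \<and> \<delta> < 1 / 4 \<and>
       1 - \<delta> < (s_min (\<Phi> * U))\<^sup>2 \<and>
       (s_min (\<Phi> * U))\<^sup>2 \<le> (s_max (\<Phi> * U))\<^sup>2 \<and>
       (s_max (\<Phi> * U))\<^sup>2 < 1 + \<delta>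
       \<longrightarrow>
       (let Y1 = (\<lambda>x. \<Phi> *\<^sub>v x) ` X1;
            Y2 = (\<lambda>x. \<Phi> *\<^sub>v x) ` X2
        in \<bar>(aff n Y1 Y2)\<^sup>2 - (aff N X1 X2)\<^sup>2\<bar> \<le> C * (real d1 - (aff N X1 X2)\<^sup>2) * \<delta>))"
proof (intro exI[of _ "3::real"] conjI allI impI)
  fix N n d d1 d2 :: nat and X X1 X2 :: "real vec set" and U \<Phi> :: "real mat" and \<delta> :: real
  assume H: "is_subspace N X \<and> subspace_dim N X = d \<and>
       is_subspace N X1 \<and> X1 \<subseteq> X \<and> subspace_dim N X1 = d1 \<and>
       is_subspace N X2 \<and> X2 \<subseteq> X \<and> subspace_dim N X2 = d2 \<and>
       d1 \<le> d2 \<and>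
       U \<in> carrier_mat N d \<and> orthonormal_basis_cols N X U \<and>
       \<Phi> \<in> carrier_mat n N \<and>
       0 < \<delta> \<and> \<delta> < 1 / 4 \<and>
       1 - \<delta> < (s_min (\<Phi> * U))\<^sup>2 \<and>
       (s_min (\<Phi> * U))\<^sup>2 \<le> (s_max (\<Phi> * U))\<^sup>2 \<and>
       (s_max (\<Phi> * U))\<^sup>2 < 1 + \<delta>"
  hence X: "is_subspace N X" "is_subspace N X1" "X1 \<subseteq> X" "is_subspace N X2" "X2 \<subseteq> X"
    and U: "U \<in> carrier_mat N d" "orthonormal_basis_cols N X U"
    and F: "\<Phi> \<in> carrier_mat n N" and d1: "subspace_dim N X1 = d1"
    and \<delta>: "0 < \<delta>" "\<delta> < 1 / 4"
    and s: "1 - \<delta> \<le> (s_min (\<Phi> * U))\<^sup>2" "(s_max (\<Phi> * U))\<^sup>2 \<le> 1 + \<delta>" by auto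
  note iso = restricted_isometry[OF X(1) U F]
  have lo: "(1 - \<delta>) * (x \<bullet> x) \<le> (\<Phi> *\<^sub>v x) \<bullet> (\<Phi> *\<^sub>v x)"
    and up: "(\<Phi> *\<^sub>v x) \<bullet> (\<Phi> *\<^sub>v x) \<le> (1 + \<delta>) * (x \<bullet> x)" if "x \<in> X" for x
    using iso[OF that] s[THEN mult_right_mono, OF scalar_prod_self_nonneg[of x]] by linarith+
  show "let Y1 = (\<lambda>x. \<Phi> *\<^sub>v x) ` X1; Y2 = (\<lambda>x. \<Phi> *\<^sub>v x) ` X2
        in \<bar>(aff n Y1 Y2)\<^sup>2 - (aff N X1 X2)\<^sup>2\<bar> \<le> 3 * (real d1 - (aff N X1 X2)\<^sup>2) * \<delta>"
    unfolding Let_def by (rule aff_sq_near_isometry[OF X F d1 \<delta> lo up])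
qed simp

end
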